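(* Let $K,R\ge1$ be integers, $T>0$, and let $\phi\in C^{K(R+1)+1}([0,T])$ be the exact solution of $\phi'(t)=f(\phi(t),t)$. Let $\mathbf{a}^s=(a^s_{k,r})_{k,r}$, $s=1,\dots,R$, be a basis of the kernel $\mathcal{K}^R$. For $\Delta t=T/N$, $t_n=n\Delta t$, $0\le n\le N-R$, define the consistency error of the $s$-th structural equation by $$\varepsilon^s_n=\sum_{k=0}^K\sum_{r=0}^R a^s_{k,r}\,\Delta t^k\,\phi^{(k)}(t_n+r\Delta t),\qquad s\in\{1,\dots,R\}.$$ Then $$|\varepsilon^s_n|\le C^s_{K,R}\,\Delta t^{K(R+1)+1},$$ where $C^s_{K,R}$ is a real number depending on $\max_{[0,T]}|\phi^{(K(R+1)+1)}|$ but independent of $\Delta t$.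
   Context: Let $M=(K+1)(R+1)$ and $\ell(k,r)=1+k(R+1)+r$ for $0\le k\le K$, $0\le r\le R$. Let $\mathcal{M}$ be the $M\times M$ matrix with entries $\mathcal{M}[m,\ell(k,r)]=\frac{(m-1)!}{(m-1-k)!}r^{m-1-k}$ if $m>k$ (with $0^0=1$) and $0$ otherwise. $\mathcal{K}^R\subset\mathbb{R}^M$ is the kernel of the $(M-R)\times M$ matrix formed by the first $M-R$ rows of $\mathcal{M}$; it has dimension $R$. Equivalently, $\mathbf{a}=(a_{k,r})\in\mathcal{K}^R$ iff $\sum_{k=0}^K\sum_{r=0}^R a_{k,r}\Delta t^k\pi^{(k)}(t_n+r\Delta t)=0$ for all polynomials $\pi$ of degree at most $K(R+1)$. The vectors $\mathbf{a}^s$ do not depend on $\Delta t$. *)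

theory Defs
  imports "HOL-Analysis.Derivative" "Jordan_Normal_Form.Matrix_Kernel"
begin

text \<open>Derivatives are taken within \<open>S\<close>, so on \<open>S = {0..T}\<close> they are one-sided at the endpoints.\<close>

definition nderiv_on :: "real set \<Rightarrow> nat \<Rightarrow> (real \<Rightarrow> real) \<Rightarrow> real \<Rightarrow> real" where
  "nderiv_on S k f = ((\<lambda>g t. vector_derivative g (at t within S)) ^^ k) f"

definition C_k_on :: "nat \<Rightarrow> (real \<Rightarrow> real) \<Rightarrow> real set \<Rightarrow> bool" where
  "C_k_on m f S \<longleftrightarrow>
     (\<forall>k<m. (nderiv_on S k f) differentiable_on S) \<and> continuous_on S (nderiv_on S m f)"

definition struct_dim :: "nat \<Rightarrow> nat \<Rightarrow> nat" where
  "struct_dim K R = (K + 1) * (R + 1)"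

text \<open>The column index of the pair \<open>(k, r)\<close>, counted from 1.\<close>

definition ell :: "nat \<Rightarrow> nat \<Rightarrow> nat \<Rightarrow> nat" where
  "ell R k r = 1 + k * (R + 1) + r"

text \<open>Matrices and vectors are indexed from 0 here: position \<open>(i, j)\<close> is the entry in row
  \<open>m = i + 1\<close> and column \<open>ell R k r = j + 1\<close>, that is, \<open>k = j div (R + 1)\<close> and
  \<open>r = j mod (R + 1)\<close>.\<close>

definition struct_entry :: "nat \<Rightarrow> nat \<Rightarrow> nat \<Rightarrow> real" where
  "struct_entry m k r =
     (if m > k then fact (m - 1) / fact (m - 1 - k) * real r ^ (m - 1 - k) else 0)"

definition struct_mat :: "nat \<Rightarrow> nat \<Rightarrow> real mat" where
  "struct_mat K R = mat (struct_dim K R) (struct_dim K R)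
     (\<lambda>(i, j). struct_entry (i + 1) (j div (R + 1)) (j mod (R + 1)))"

definition struct_mat_top :: "nat \<Rightarrow> nat \<Rightarrow> real mat" where
  "struct_mat_top K R = mat (struct_dim K R - R) (struct_dim K R) (\<lambda>(i, j). struct_mat K R $$ (i, j))"

definition consistency_error ::
  "nat \<Rightarrow> nat \<Rightarrow> real vec \<Rightarrow> real \<Rightarrow> nat \<Rightarrow> (real \<Rightarrow> real) \<Rightarrow> nat \<Rightarrow> real" where
  "consistency_error K R b T N \<phi> n =
     (let \<Delta>t = T / real N; t = real n * \<Delta>t in
       \<Sum>k\<le>K. \<Sum>r\<le>R. b $ (ell R k r - 1) * \<Delta>t ^ k * nderiv_on {0..T} k \<phi> (t + real r * \<Delta>t))"

end

theory Submission
  imports Defs "HOL-Analysis.Complex_Analysis_Basics"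
begin

unbundle no vec_syntax

text \<open>Let \<open>P = K (R + 1)\<close>. Expanding each \<open>\<phi>\<^sup>(\<^sup>k\<^sup>)(t\<^sub>n + r \<Delta>t)\<close> about
  \<open>t\<^sub>n\<close> to total order \<open>P\<close> and collecting the coefficient of \<open>\<phi>\<^sup>(\<^sup>j\<^sup>)(t\<^sub>n) \<Delta>t\<^sup>j / j!\<close>,
  one finds row \<open>j + 1\<close> of the structure matrix applied to the coefficient vector. Since the
  first \<open>P + 1\<close> rows annihilate the vector, only the Taylor remainders survive, each of
  order \<open>\<Delta>t\<^sup>P\<^sup>+\<^sup>1\<close>.\<close>

lemma nderiv_on_has_real_derivative:
  assumes "C_k_on m f S" "k < m" "x \<in> S"
  shows "(nderiv_on S k f has_real_derivative nderiv_on S (Suc k) f x) (at x within S)"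
proof -
  have "nderiv_on S k f differentiable at x within S"
    using assms by (auto simp: C_k_on_def differentiable_on_def)
  then show ?thesis
    unfolding has_real_derivative_iff_has_vector_derivative vector_derivative_works
    by (simp add: nderiv_on_def)
qed

text \<open>A real \<open>SUP\<close> bounds its members only when the set is bounded above. Here
  the set is a continuous image of a compact set.\<close>

lemma abs_nderiv_on_le_SUP:
  assumes "C_k_on m f S" "compact S" "x \<in> S"
  shows "\<bar>nderiv_on S m f x\<bar> \<le> (SUP t\<in>S. \<bar>nderiv_on S m f t\<bar>)"
proof (rule cSUP_upper[OF assms(3)])
  have "compact ((\<lambda>t. \<bar>nderiv_on S m f t\<bar>) ` S)"
    using assms by (intro compact_continuous_image continuous_intros) (auto simp: C_k_on_def)
  then show "bdd_above ((\<lambda>t. \<bar>nderiv_on S m f t\<bar>) ` S)"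
    by (simp add: compact_imp_bounded bounded_imp_bdd_above)
qed

text \<open>This is \<open>field_Taylor\<close> for the sequence of derivatives starting at order
  \<open>k\<close>. Its remainder has \<open>fact (p - k)\<close> in the denominator instead of the
  sharp \<open>fact (Suc (p - k))\<close>; only the power of \<open>z - w\<close> matters
  later.\<close>

lemma nderiv_on_Taylor:
  assumes "C_k_on (Suc p) f S" "convex S" "k \<le> p"
    and "\<And>x. x \<in> S \<Longrightarrow> \<bar>nderiv_on S (Suc p) f x\<bar> \<le> B" "w \<in> S" "z \<in> S"
  shows "\<bar>nderiv_on S k f z - (\<Sum>i\<le>p - k. nderiv_on S (k + i) f w * (z - w) ^ i / fact i)\<bar>
    \<le> B * \<bar>z - w\<bar> ^ Suc (p - k) / fact (p - k)"
proof -
  \<comment> \<open>Writing \<open>k + 0\<close> lets unification pick the sequence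
    \<open>\<lambda>i. nderiv_on S (k + i) f\<close>.\<close>
  have "norm (nderiv_on S (k + 0) f z
      - (\<Sum>i\<le>p - k. nderiv_on S (k + i) f w * (z - w) ^ i / fact i))
    \<le> B * norm (z - w) ^ Suc (p - k) / fact (p - k)"
    using assms nderiv_on_has_real_derivative[OF assms(1)]
    by (intro field_Taylor[where S = S]) auto
  then show ?thesis
    by simp
qed

lemma sum_struct_entry_eq_0:
  assumes "v \<in> mat_kernel (struct_mat_top K R)" "j \<le> K * (R + 1)"
  shows "(\<Sum>k\<le>K. \<Sum>r\<le>R. v $ (ell R k r - 1) * struct_entry (Suc j) k r) = 0"
proof -
  let ?M = "struct_mat_top K R"
  let ?g = "\<lambda>l. v $ l * struct_entry (Suc j) (l div (R + 1)) (l mod (R + 1))"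
  have M: "?M \<in> carrier_mat (struct_dim K R - R) (struct_dim K R)"
    by (simp add: struct_mat_top_def)
  \<comment> \<open>(K + 1)(R + 1) - R = K(R + 1) + 1, so the retained rows, counted from 0, are
    exactly 0, ..., K(R + 1).\<close>
  have j: "j < struct_dim K R - R"
    using assms(2) by (simp add: struct_dim_def)
  have v: "v \<in> carrier_vec (struct_dim K R)" "?M *\<^sub>v v = 0\<^sub>v (struct_dim K R - R)"
    using mat_kernelD[OF M assms(1)] by auto
  \<comment> \<open>The columns split into K + 1 consecutive blocks of length R + 1, one for each
    derivative order; joining them turns the double sum into a single row-times-vector
    product.\<close>
  have "(\<Sum>k\<le>K. \<Sum>r\<le>R. v $ (ell R k r - 1) * struct_entry (Suc j) k r)
      = (\<Sum>k<K + 1. sum ?g {k * (R + 1)..<k * (R + 1) + (R + 1)})"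
  proof (rule sum.cong)
    fix k assume "k \<in> {..<K + 1}"
    have "sum ?g {k * (R + 1)..<k * (R + 1) + (R + 1)} = (\<Sum>r\<in>{0..<R + 1}. ?g (r + k * (R + 1)))"
      using sum.shift_bounds_nat_ivl[of ?g 0 "k * (R + 1)" "R + 1"] by (simp add: add.commute)
    also have "\<dots> = (\<Sum>r\<le>R. v $ (ell R k r - 1) * struct_entry (Suc j) k r)"
    proof (intro sum.cong)
      fix r assume r: "r \<in> {..R}"
      \<comment> \<open>\<open>ell\<close> counts from 1, so the column counted from 0 is k(R + 1) +
        r; since r \<le> R, division by R + 1 recovers the pair.\<close>
      then have "(r + k * (R + 1)) div (R + 1) = k" "(r + k * (R + 1)) mod (R + 1) = r"
        by (subst div_mult_self1; simp) (subst mod_mult_self1; use r in simp)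
      then show "?g (r + k * (R + 1)) = v $ (ell R k r - 1) * struct_entry (Suc j) k r"
        by (simp only: ell_def) (simp add: add.commute)
    qed auto
    finally show "(\<Sum>r\<le>R. v $ (ell R k r - 1) * struct_entry (Suc j) k r)
      = sum ?g {k * (R + 1)..<k * (R + 1) + (R + 1)}" by simp
  qed auto
  also have "\<dots> = sum ?g {..<struct_dim K R}"
    by (simp only: sum.nat_group struct_dim_def)
  also have "\<dots> = (?M *\<^sub>v v) $ j"
    using j v(1) M
    by (auto simp: struct_mat_top_def struct_mat_def scalar_prod_def atLeast0LessThan
        intro!: sum.cong)
  also have "\<dots> = 0"
    using v(2) j by simp
  finally show ?thesis .
qed

text \<open>This is exactness on polynomials of degree at most K(R + 1), with \<open>g j\<close> in
  the role of the j-th derivative at the base point. Once the sum over total order is outermost,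
  each coefficient is one kernel equation.\<close>

lemma sum_Taylor_polynomials_eq_0:
  fixes g :: "nat \<Rightarrow> real"
  assumes "v \<in> mat_kernel (struct_mat_top K R)"
  shows "(\<Sum>k\<le>K. \<Sum>r\<le>R. v $ (ell R k r - 1) * h ^ k *
      (\<Sum>i\<le>K * (R + 1) - k. g (k + i) * (real r * h) ^ i / fact i)) = 0"
proof -
  define P where "P = K * (R + 1)"
  have inner: "h ^ k * (\<Sum>i\<le>P - k. g (k + i) * (real r * h) ^ i / fact i)
      = (\<Sum>j\<le>P. g j * h ^ j / fact j * struct_entry (Suc j) k r)" if "k \<le> K" for k r
  proof -
    have "k \<le> P"
      using that by (simp add: P_def)
    \<comment> \<open>Entries with j < k vanish. For j = k + i the entry is (k + i)!/i! times r^i,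
      so the factorial of the total order cancels and the Taylor coefficient 1/i! remains.\<close>
    have "(\<Sum>j\<le>P. g j * h ^ j / fact j * struct_entry (Suc j) k r)
        = (\<Sum>j\<in>{k..P}. g j * h ^ j / fact j * struct_entry (Suc j) k r)"
      by (rule sum.mono_neutral_right) (auto simp: struct_entry_def)
    also have "\<dots> = (\<Sum>i\<le>P - k. g (k + i) * h ^ (k + i) / fact (k + i) * struct_entry (Suc (k + i)) k r)"
      using \<open>k \<le> P\<close>
      by (intro sum.reindex_bij_witness[of _ "\<lambda>i. k + i" "\<lambda>j. j - k"]) auto
    also have "\<dots> = (\<Sum>i\<le>P - k. h ^ k * (g (k + i) * (real r * h) ^ i / fact i))"
      by (intro sum.cong) (auto simp: struct_entry_def power_add power_mult_distrib)
    finally show ?thesis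
      by (simp add: sum_distrib_left)
  qed
  have "(\<Sum>k\<le>K. \<Sum>r\<le>R. v $ (ell R k r - 1) * h ^ k *
      (\<Sum>i\<le>P - k. g (k + i) * (real r * h) ^ i / fact i))
    = (\<Sum>k\<le>K. \<Sum>r\<le>R. \<Sum>j\<le>P. g j * h ^ j / fact j
        * (v $ (ell R k r - 1) * struct_entry (Suc j) k r))"
  proof (intro sum.cong refl)
    fix k r assume "k \<in> {..K}" "r \<in> {..R}"
    then have "v $ (ell R k r - 1) * h ^ k * (\<Sum>i\<le>P - k. g (k + i) * (real r * h) ^ i / fact i)
      = v $ (ell R k r - 1) * (\<Sum>j\<le>P. g j * h ^ j / fact j * struct_entry (Suc j) k r)"
      by (simp only: mult.assoc inner atMost_iff)
    then show "v $ (ell R k r - 1) * h ^ k * (\<Sum>i\<le>P - k. g (k + i) * (real r * h) ^ i / fact i)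
      = (\<Sum>j\<le>P. g j * h ^ j / fact j * (v $ (ell R k r - 1) * struct_entry (Suc j) k r))"
      by (simp only: sum_distrib_left mult.left_commute)
  qed
  also have "\<dots> = (\<Sum>k\<le>K. \<Sum>j\<le>P. \<Sum>r\<le>R. g j * h ^ j / fact j
        * (v $ (ell R k r - 1) * struct_entry (Suc j) k r))"
    by (intro sum.cong refl sum.swap)
  also have "\<dots> = (\<Sum>j\<le>P. \<Sum>k\<le>K. \<Sum>r\<le>R. g j * h ^ j / fact j
        * (v $ (ell R k r - 1) * struct_entry (Suc j) k r))"
    by (rule sum.swap)
  also have "\<dots> = (\<Sum>j\<le>P. g j * h ^ j / fact j *
      (\<Sum>k\<le>K. \<Sum>r\<le>R. v $ (ell R k r - 1) * struct_entry (Suc j) k r))"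
    by (simp only: sum_distrib_left)
  also have "\<dots> = 0"
    using sum_struct_entry_eq_0[OF assms] by (simp add: P_def)
  finally show ?thesis
    by (simp only: P_def)
qed

lemma consistency_error_le:
  assumes v: "v \<in> mat_kernel (struct_mat_top K R)"
    and "T > 0" and C: "C_k_on (K * (R + 1) + 1) \<phi> {0..T}" and "N \<ge> 1" "n + R \<le> N"
  shows "\<bar>consistency_error K R v T N \<phi> n\<bar>
    \<le> (SUP t\<in>{0..T}. \<bar>nderiv_on {0..T} (K * (R + 1) + 1) \<phi> t\<bar>)
      * (\<Sum>k\<le>K. \<Sum>r\<le>R. \<bar>v $ (ell R k r - 1)\<bar>
          * (real r ^ Suc (K * (R + 1) - k) / fact (K * (R + 1) - k)))
      * (T / real N) ^ (K * (R + 1) + 1)"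
proof -
  define P where "P = K * (R + 1)"
  define h where "h = T / real N"
  define w where "w = real n * h"
  define g where "g j = nderiv_on {0..T} j \<phi> w" for j
  define B where "B = (SUP t\<in>{0..T}. \<bar>nderiv_on {0..T} (K * (R + 1) + 1) \<phi> t\<bar>)"
  have h: "h > 0"
    using assms by (simp add: h_def)
  \<comment> \<open>The condition n + R \<le> N keeps the whole stencil in [0, T], where the Taylor
    estimate and the bound \<open>B\<close> are available.\<close>
  have node: "w + real r * h \<in> {0..T}" if "r \<le> R" for r
  proof -
    have "real (n + r) * h \<le> real N * h"
      using that assms h by (intro mult_right_mono) auto
    also have "\<dots> = T"
      using assms by (simp add: h_def)
    finally show ?thesis
      using h by (simp add: w_def algebra_simps)
  qed
  have B: "\<bar>nderiv_on {0..T} (Suc P) \<phi> x\<bar> \<le> B" if "x \<in> {0..T}" for x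
    using abs_nderiv_on_le_SUP[OF C compact_Icc that] by (simp add: B_def P_def)
  have C': "C_k_on (Suc P) \<phi> {0..T}"
    using C by (simp add: P_def)
  let ?e = "\<lambda>k r. nderiv_on {0..T} k \<phi> (w + real r * h)
    - (\<Sum>i\<le>P - k. g (k + i) * (real r * h) ^ i / fact i)"
  have "consistency_error K R v T N \<phi> n
      = (\<Sum>k\<le>K. \<Sum>r\<le>R. v $ (ell R k r - 1) * h ^ k * nderiv_on {0..T} k \<phi> (w + real r * h))"
    by (simp add: consistency_error_def h_def w_def Let_def)
  \<comment> \<open>Subtracting the Taylor polynomials is free, because their weighted sum is
    zero.\<close>
  also have "\<dots> = (\<Sum>k\<le>K. \<Sum>r\<le>R. v $ (ell R k r - 1) * h ^ k * ?e k r)"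
    using sum_Taylor_polynomials_eq_0[OF v, of h g]
    by (simp add: right_diff_distrib sum_subtractf P_def)
  finally have "\<bar>consistency_error K R v T N \<phi> n\<bar>
      = \<bar>\<Sum>k\<le>K. \<Sum>r\<le>R. v $ (ell R k r - 1) * h ^ k * ?e k r\<bar>"
    by (rule arg_cong)
  also have "\<dots> \<le> (\<Sum>k\<le>K. \<Sum>r\<le>R. \<bar>v $ (ell R k r - 1) * h ^ k * ?e k r\<bar>)"
    by (rule order.trans[OF sum_abs sum_mono[OF sum_abs]])
  also have "\<dots> \<le> (\<Sum>k\<le>K. \<Sum>r\<le>R. B * (\<bar>v $ (ell R k r - 1)\<bar>
      * (real r ^ Suc (P - k) / fact (P - k))) * h ^ (P + 1))"
  proof (intro sum_mono)
    fix k r assume kr: "k \<in> {..K}" "r \<in> {..R}"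
    then have k: "k \<le> P"
      by (simp add: P_def trans_le_add1)
    have "\<bar>?e k r\<bar> \<le> B * \<bar>real r * h\<bar> ^ Suc (P - k) / fact (P - k)"
      using nderiv_on_Taylor[OF C' convex_real_interval(5) k B, of w "w + real r * h"]
        node[of r] node[of 0] kr by (simp add: g_def)
    then have "\<bar>v $ (ell R k r - 1)\<bar> * h ^ k * \<bar>?e k r\<bar>
      \<le> \<bar>v $ (ell R k r - 1)\<bar> * h ^ k * (B * \<bar>real r * h\<bar> ^ Suc (P - k) / fact (P - k))"
      using h by (intro mult_left_mono) auto
    also have "\<dots> = B * (\<bar>v $ (ell R k r - 1)\<bar> * (real r ^ Suc (P - k) / fact (P - k)))
        * (h ^ k * h ^ Suc (P - k))"
      using h by (simp add: power_mult_distrib abs_mult)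
    \<comment> \<open>The weight h^k makes up for the k orders lost by expanding the k-th derivative
      only to degree P - k, so all terms have the same order.\<close>
    also have "h ^ k * h ^ Suc (P - k) = h ^ (P + 1)"
      using k by (simp flip: power_add)
    finally show "\<bar>v $ (ell R k r - 1) * h ^ k * ?e k r\<bar>
      \<le> B * (\<bar>v $ (ell R k r - 1)\<bar> * (real r ^ Suc (P - k) / fact (P - k))) * h ^ (P + 1)"
      using h by (simp add: abs_mult)
  qed
  also have "\<dots> = B * (\<Sum>k\<le>K. \<Sum>r\<le>R. \<bar>v $ (ell R k r - 1)\<bar>
      * (real r ^ Suc (P - k) / fact (P - k))) * h ^ (P + 1)"
    by (simp only: sum_distrib_left sum_distrib_right)
  finally show ?thesis
    by (simp only: B_def P_def h_def)
qed

theorem proposition8p2: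
  fixes K R :: nat and a :: "nat \<Rightarrow> real vec"
  assumes "K \<ge> 1" and "R \<ge> 1"
    and "inj_on a {1..R}"
    and "kernel.basis (struct_dim K R) (struct_mat_top K R) (a ` {1..R})"
  shows "\<forall>s\<in>{1..R}. \<exists>C :: real \<Rightarrow> real.
    \<forall>(T :: real) (f :: real \<Rightarrow> real \<Rightarrow> real) (\<phi> :: real \<Rightarrow> real) (N :: nat) (n :: nat).
      T > 0 \<longrightarrow>
      C_k_on (K * (R + 1) + 1) \<phi> {0..T} \<longrightarrow>
      (\<forall>t\<in>{0..T}. (\<phi> has_real_derivative f (\<phi> t) t) (at t within {0..T})) \<longrightarrow>
      N \<ge> 1 \<longrightarrow> n + R \<le> N \<longrightarrow>
      \<bar>consistency_error K R (a s) T N \<phi> n\<bar>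
        \<le> C (SUP t\<in>{0..T}. \<bar>nderiv_on {0..T} (K * (R + 1) + 1) \<phi> t\<bar>)
            * (T / real N) ^ (K * (R + 1) + 1)"
proof -
  interpret kernel "struct_dim K R - R" "struct_dim K R" "struct_mat_top K R"
    by unfold_locales (simp add: struct_mat_top_def)
  show ?thesis (is "\<forall>s\<in>_. \<exists>C. ?P s C")
  proof
    fix s assume "s \<in> {1..R}"
    then have "a s \<in> mat_kernel (struct_mat_top K R)"
      using assms(4) by (auto simp: Ker.basis_def)
    from consistency_error_le[OF this] show "\<exists>C. ?P s C"
      \<comment> \<open>The witness is linear in the maximum \<open>D\<close>, and its slope depends
        only on \<open>K\<close>, \<open>R\<close> and \<open>a s\<close>, so it serves every
        \<open>T\<close>, \<open>\<phi>\<close>, \<open>N\<close> and \<open>n\<close> at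
        once.\<close>
      by (intro exI[of _ "\<lambda>D. D * (\<Sum>k\<le>K. \<Sum>r\<le>R. \<bar>a s $ (ell R k r - 1)\<bar>
          * (real r ^ Suc (K * (R + 1) - k) / fact (K * (R + 1) - k)))"]) blast
  qed
qed

end
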